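(* Let $G$ be a bipartite graph. Then $G$ is matching double covered if and only if $G$ is (isomorphic to) $K_{3,3}$ or $C_4^4$.
   Context: Graphs are finite, loopless, and may have parallel edges (parallel edges are distinct edges, so perfect matchings differing only by the choice of a parallel edge are different). All graphs considered admit a perfect matching (in particular have at least one edge). A connected graph is matching double covered if every edge belongs to exactly two perfect matchings. $C_4^4$ is the graph obtained from the $4$-cycle by replacing every edge by two parallel edges. $K_{3,3}$ is the complete bipartite graph. *)

theory Defs
  imports Main
begin

record ('v, 'e) multigraph =
  verts :: "'v set"
  edges :: "'e set"
  ends :: "'e \<Rightarrow> 'v set"

text \<open>Edges carry their own identity, so distinct edges with the same set of ends are parallel
  edges; looplessness is the requirement that every edge has exactly two ends.\<close>

definition loopless_multigraph :: "('v, 'e) multigraph \<Rightarrow> bool" where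
  "loopless_multigraph G \<longleftrightarrow>
     finite (verts G) \<and> finite (edges G) \<and>
     (\<forall>e \<in> edges G. ends G e \<subseteq> verts G \<and> card (ends G e) = 2)"

definition perfect_matching :: "('v, 'e) multigraph \<Rightarrow> 'e set \<Rightarrow> bool" where
  "perfect_matching G M \<longleftrightarrow>
     M \<subseteq> edges G \<and> (\<forall>v \<in> verts G. \<exists>!e. e \<in> M \<and> v \<in> ends G e)"

definition bipartite_graph :: "('v, 'e) multigraph \<Rightarrow> bool" where
  "bipartite_graph G \<longleftrightarrow>
     (\<exists>A B. A \<union> B = verts G \<and> A \<inter> B = {} \<and>
        (\<forall>e \<in> edges G. \<exists>a \<in> A. \<exists>b \<in> B. ends G e = {a, b}))"

definition adjacency :: "('v, 'e) multigraph \<Rightarrow> 'v rel" where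
  "adjacency G = {(u, v). \<exists>e \<in> edges G. ends G e = {u, v}}"

definition connected_graph :: "('v, 'e) multigraph \<Rightarrow> bool" where
  "connected_graph G \<longleftrightarrow>
     verts G \<noteq> {} \<and> (\<forall>u \<in> verts G. \<forall>v \<in> verts G. (u, v) \<in> (adjacency G)\<^sup>*)"

definition matching_double_covered :: "('v, 'e) multigraph \<Rightarrow> bool" where
  "matching_double_covered G \<longleftrightarrow>
     connected_graph G \<and>
     (\<forall>e \<in> edges G. card {M. perfect_matching G M \<and> e \<in> M} = 2)"

definition graph_iso :: "('v, 'e) multigraph \<Rightarrow> ('w, 'f) multigraph \<Rightarrow> bool" where
  "graph_iso G H \<longleftrightarrow>
     (\<exists>f g. bij_betw f (verts G) (verts H) \<and> bij_betw g (edges G) (edges H) \<and>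
        (\<forall>e \<in> edges G. ends H (g e) = f ` ends G e))"

definition complete_bipartite :: "nat \<Rightarrow> nat \<Rightarrow> (nat + nat, nat \<times> nat) multigraph" where
  "complete_bipartite m n =
     \<lparr>verts = {..<m} <+> {..<n}, edges = {..<m} \<times> {..<n}, ends = (\<lambda>(i, j). {Inl i, Inr j})\<rparr>"

definition cycle_graph :: "nat \<Rightarrow> (nat, nat) multigraph" where
  "cycle_graph n =
     \<lparr>verts = {..<n}, edges = {..<n}, ends = (\<lambda>i. {i, (i + 1) mod n})\<rparr>"

text \<open>Every edge is replaced by two parallel copies, told apart by a Boolean tag.\<close>

definition double_edges :: "('v, 'e) multigraph \<Rightarrow> ('v, 'e \<times> bool) multigraph" where
  "double_edges G =
     \<lparr>verts = verts G, edges = edges G \<times> UNIV, ends = (\<lambda>(e, b). ends G e)\<rparr>"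

definition C44 :: "(nat, nat \<times> bool) multigraph" where
  "C44 = double_edges (cycle_graph 4)"

end

theory Submission
  imports Defs
begin

text \<open>
  Fix a perfect matching \<open>M\<close> of a matching double covered bipartite graph with sides \<open>A\<close> and \<open>B\<close>,
  and contract it: the remaining edges become arcs of a digraph \<open>D\<close> on \<open>A\<close>, and the perfect
  matchings other than \<open>M\<close> correspond to the nonempty sets of vertex-disjoint directed cycles
  of \<open>D\<close>. The covering condition on an edge of \<open>M\<close> says that every vertex \<open>v\<close> is avoided by
  exactly one such set \<open>C\<^sub>v\<close>; counting matchings at each vertex shows that the graph is regular.
  Let \<open>D\<close> have at least three vertices. A loop of \<open>D\<close> at \<open>x\<close> forces \<open>D - x\<close> to be a single
  Hamiltonian cycle, which contradicts regularity, so applying this to all \<open>M\<close> the graph is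
  simple. If \<open>w\<close> lies on \<open>C\<^sub>v\<close> then \<open>D - v - w\<close> is acyclic and has a sink, whose arcs all go to
  \<open>v\<close> or \<open>w\<close>. Hence \<open>D\<close> is 2-regular and, as the sinks for different \<open>w\<close> are different
  predecessors of \<open>v\<close>, each \<open>C\<^sub>v\<close> is a digon. With four or more vertices two digons or a
  digon and a triangle avoid a common vertex. So \<open>card A = 3\<close>, and graphs with \<open>card A \<le> 2\<close>
  are treated directly.
\<close>

section \<open>Digraphs in which every vertex is avoided by exactly one cycle set\<close>

locale arc_system =
  fixes V :: "'v set" and E :: "'e set" and l h :: "'e \<Rightarrow> 'v"
  assumes finV: "finite V" and finE: "finite E"
    and lV: "e \<in> E \<Longrightarrow> l e \<in> V" and hV: "e \<in> E \<Longrightarrow> h e \<in> V"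
begin

text \<open>Arc sets of nonempty unions of vertex-disjoint directed cycles, loops included.\<close>

definition cycles :: "'e set \<Rightarrow> bool" where
  "cycles C \<longleftrightarrow> C \<subseteq> E \<and> C \<noteq> {} \<and> inj_on l C \<and> inj_on h C \<and> l ` C = h ` C"

text \<open>Following the chosen arcs never leaves the finite set \<open>S\<close>, so they run into
  a cycle. This is how the absence of sinks later yields cycle sets.\<close>

lemma closed_choice_cycles:
  assumes "S \<subseteq> V" "S \<noteq> {}"
    and g: "\<And>v. v \<in> S \<Longrightarrow> g v \<in> E \<and> l (g v) = v \<and> h (g v) \<in> S"
  shows "\<exists>C \<subseteq> g ` S. cycles C"
proof -
  let ?Q = "\<lambda>T. T \<subseteq> S \<and> T \<noteq> {} \<and> (h \<circ> g) ` T \<subseteq> T"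
  have "?Q S" using assms by auto
  \<comment> \<open>The image of \<open>T\<close> under \<open>h \<circ> g\<close> is again closed,
    so least cardinality makes \<open>h \<circ> g\<close> a permutation of \<open>T\<close>.\<close>
  then obtain T where T: "?Q T" and min: "\<And>T'. ?Q T' \<Longrightarrow> card T \<le> card T'"
    using ex_has_least_nat[of ?Q S card] by blast
  have fT: "finite T" using T assms(1) finV by (meson finite_subset)
  have "?Q ((h \<circ> g) ` T)" using T by blast
  then have "card T \<le> card ((h \<circ> g) ` T)" by (rule min)
  then have eq: "(h \<circ> g) ` T = T" using T fT by (intro card_seteq) auto
  then have inj: "inj_on (h \<circ> g) T" using fT by (simp add: eq_card_imp_inj_on)
  have "l ` g ` T = T" using T g by (force simp: image_iff)
  moreover have "inj_on l (g ` T)" using T g by (auto simp: inj_on_def subset_iff)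
  moreover have "inj_on h (g ` T)" using inj by (rule inj_on_imageI)
  ultimately have "cycles (g ` T)" using T g eq unfolding cycles_def
    by (auto simp: image_comp)
  moreover have "g ` T \<subseteq> g ` S" using T by (intro image_mono) simp
  ultimately show ?thesis by (intro exI[of _ "g ` T"] conjI)
qed

end

text \<open>What contraction of a perfect matching leaves: cycle sets avoiding \<open>v\<close>
  stand for the other perfect matchings through the matching edge at \<open>v\<close>, and
  \<open>d\<close> is the degree of the graph minus one.\<close>

locale unique_cycles = arc_system V E l h
  for V :: "'v set" and E :: "'e set" and l h :: "'e \<Rightarrow> 'v" +
  fixes d :: nat
  assumes avoiding: "v \<in> V \<Longrightarrow> \<exists>C. cycles C \<and> v \<notin> l ` C"
    and avoiding_unique: "\<lbrakk>v \<in> V; cycles C; v \<notin> l ` C; cycles C'; v \<notin> l ` C'\<rbrakk> \<Longrightarrow> C = C'"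
    and outdeg: "v \<in> V \<Longrightarrow> card {e \<in> E. l e = v} = d"
    and indeg: "v \<in> V \<Longrightarrow> card {e \<in> E. h e = v} = d"
    and weakly_connected:
      "\<lbrakk>S \<subseteq> V; S \<noteq> {}; S \<noteq> V\<rbrakk> \<Longrightarrow> \<exists>e \<in> E. (l e \<in> S) \<noteq> (h e \<in> S)"
    and card_V: "card V \<ge> 3"
begin

lemma vertex_outside: "\<exists>v \<in> V. v \<notin> {a, b}"
proof (rule ccontr)
  assume "\<not> ?thesis"
  then have "V \<subseteq> {a, b}" by auto
  then have "card V \<le> card {a, b}" by (intro card_mono) auto
  also have "\<dots> \<le> 2" by (simp add: card_insert_if)
  finally show False using card_V by simp
qed

text \<open>If \<open>d \<le> 1\<close>, a cycle set uses up all arcs at its vertices, so no arc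
  enters or leaves its vertex set. This set is nonempty and misses \<open>x\<close>, against weak
  connectedness.\<close>

lemma degree_ge_2: "d \<ge> 2"
proof (rule ccontr)
  assume "\<not> ?thesis"
  then have d: "d \<le> 1" by simp
  obtain x where x: "x \<in> V" using card_V by fastforce
  obtain C where C: "cycles C" "x \<notin> l ` C" using avoiding[OF x] by blast
  have one: "e = e'" if "e \<in> E" "e' \<in> E" "l e = l e' \<or> h e = h e'" for e e'
  proof -
    have "card {f \<in> E. l f = l e} \<le> 1" "card {f \<in> E. h f = h e} \<le> 1"
      using outdeg indeg that d lV hV by auto
    then show ?thesis using that finE by (auto simp: card_le_Suc0_iff_eq)
  qed
  have "\<exists>e \<in> E. (l e \<in> l ` C) \<noteq> (h e \<in> l ` C)"
    using C x by (intro weakly_connected) (use lV hV in \<open>auto simp: cycles_def subset_iff image_iff\<close>)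
  then obtain e where e: "e \<in> E" "(l e \<in> l ` C) \<noteq> (h e \<in> h ` C)"
    using C by (auto simp: cycles_def)
  then obtain f where "f \<in> C" "l e = l f \<or> h e = h f" by auto
  moreover from this have "f \<in> E" using C by (auto simp: cycles_def)
  ultimately have "e \<in> C" using one[of e f] e by auto
  then show False using e by auto
qed


lemma no_loop:
  assumes e: "e \<in> E" shows "l e \<noteq> h e"
proof
  define x where "x = l e"
  assume loop: "l e = h e"
  have x: "x \<in> V" and ce: "cycles {e}" using e loop lV[OF e] by (auto simp: x_def cycles_def)
  obtain C where C: "cycles C" "x \<notin> l ` C" using avoiding[OF x] by blast
  have CE: "C \<subseteq> E" using C by (simp add: cycles_def)
  \<comment> \<open>A vertex missed by \<open>C\<close> would be avoided by both \<open>C\<close>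
    and the loop \<open>{e}\<close>, so these would coincide.\<close>
  have cover: "y \<in> l ` C" if "y \<in> V" "y \<noteq> x" for y
  proof (rule ccontr)
    assume "y \<notin> l ` C"
    then have "C = {e}" using that C ce by (intro avoiding_unique[of y]) (auto simp: x_def)
    then show False using C by (simp add: x_def)
  qed
  define c where "c = inv_into C l"
  have c: "c y \<in> C \<and> l (c y) = y" if "y \<in> V" "y \<noteq> x" for y
    using cover[OF that] by (simp add: c_def inv_into_into f_inv_into_f)
  have hc: "h f \<noteq> x" if "f \<in> C" for f
    using C that by (auto simp: cycles_def)
  \<comment> \<open>Replace the arc of \<open>C\<close> out of \<open>l f\<close> by
    \<open>f\<close>. The choice stays off \<open>x\<close>, so the cycle set inside it must be
    \<open>C\<close> again; \<open>C\<close> has an arc out of \<open>l f\<close>, and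
    \<open>f\<close> is the only candidate.\<close>
  have chord: "f \<in> C" if f: "f \<in> E" "l f \<noteq> x" "h f \<noteq> x" for f
  proof -
    let ?g = "c(l f := f)" and ?S = "V - {x}"
    have g: "?g v \<in> E \<and> l (?g v) = v \<and> h (?g v) \<in> ?S" if "v \<in> ?S" for v
      using that f c[of v] CE hc[of "c v"] hV by auto
    have "l f \<in> ?S" using f lV by simp
    then obtain C' where C': "C' \<subseteq> ?g ` ?S" "cycles C'"
      using closed_choice_cycles[of ?S ?g] g by blast
    have "x \<notin> l ` C'" using C'(1) g by fastforce
    then have "C' = C" using C C' x avoiding_unique by blast
    moreover have cf: "c (l f) \<in> C" "l (c (l f)) = l f" using c[of "l f"] f lV by auto
    ultimately obtain v where v: "v \<in> ?S" "c (l f) = ?g v" using C'(1) by blast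
    then have "v = l f" using g[OF v(1)] cf by simp
    then show ?thesis using v cf by simp
  qed
  obtain y where y: "y \<in> V" "y \<noteq> x" using vertex_outside[of x x] by auto
  obtain z where z: "z \<in> V" "z \<notin> {x, y}"
    using vertex_outside[of x y] by auto
  \<comment> \<open>By \<open>chord\<close>, every arc out of \<open>v\<close> other than
    \<open>c v\<close> leads to \<open>x\<close>.\<close>
  have to_x: "{f \<in> E. l f = v} - {c v} \<subseteq> {f \<in> E. h f = x}" if "v \<in> V" "v \<noteq> x" for v
  proof
    fix f assume f: "f \<in> {f \<in> E. l f = v} - {c v}"
    then have "f \<notin> C" using c[OF that] C by (auto simp: cycles_def inj_on_def)
    then show "f \<in> {f \<in> E. h f = x}" using f chord that by auto
  qed
  have card: "card ({f \<in> E. l f = v} - {c v}) = d - 1" if "v \<in> V" "v \<noteq> x" for v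
    using outdeg[of v] c[of v] that CE finE by (subst card_Diff_singleton) auto
  let ?Y = "{f \<in> E. l f = y} - {c y}" and ?Z = "{f \<in> E. l f = z} - {c z}"
  \<comment> \<open>The vertices \<open>y\<close> and \<open>z\<close> each send
    \<open>d - 1\<close> arcs to \<open>x\<close>, and the loop is one more. So
    \<open>2 * (d - 1) + 1 \<le> d\<close>, which fails for \<open>d \<ge> 2\<close>.\<close>
  have "card (insert e (?Y \<union> ?Z)) \<le> card {f \<in> E. h f = x}"
    using to_x[OF y] to_x[of z] z e loop finE by (intro card_mono) (auto simp: x_def)
  moreover have "card (insert e (?Y \<union> ?Z)) = Suc (card (?Y \<union> ?Z))"
    using finE y z by (intro card_insert_disjoint) (auto simp: x_def)
  moreover have "card (?Y \<union> ?Z) = card ?Y + card ?Z"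
    using finE z by (intro card_Un_disjoint) auto
  ultimately have "Suc (2 * (d - 1)) \<le> d" using card y z indeg[OF x] by simp
  then show False using degree_ge_2 by linarith
qed

lemma card_eq_3_if_simple:
  assumes simple: "\<And>e e'. \<lbrakk>e \<in> E; e' \<in> E; l e = l e'; h e = h e'\<rbrakk> \<Longrightarrow> e = e'"
  shows "card V = 3" and "d = 2"
proof -
  define N where "N u v \<longleftrightarrow> (\<exists>e \<in> E. l e = u \<and> h e = v)" for u v
  have NV: "u \<in> V" "v \<in> V" "u \<noteq> v" if "N u v" for u v
    using that lV hV no_loop by (auto simp: N_def)
  have succ: "finite {w. N v w}" "card {w. N v w} = d" if "v \<in> V" for v
  proof -
    have "{w. N v w} = h ` {e \<in> E. l e = v}" by (auto simp: N_def)
    moreover have "inj_on h {e \<in> E. l e = v}" using simple by (auto simp: inj_on_def)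
    ultimately show "finite {w. N v w}" "card {w. N v w} = d"
      using outdeg[OF that] finE by (simp_all add: card_image)
  qed
  have pred: "finite {w. N w v}" "card {w. N w v} = d" if "v \<in> V" for v
  proof -
    have "{w. N w v} = l ` {e \<in> E. h e = v}" by (auto simp: N_def)
    moreover have "inj_on l {e \<in> E. h e = v}" using simple by (auto simp: inj_on_def)
    ultimately show "finite {w. N w v}" "card {w. N w v} = d"
      using indeg[OF that] finE by (simp_all add: card_image)
  qed
  \<comment> \<open>If every vertex off \<open>{v, w}\<close> had an arc staying off it, some cycle
    set would avoid both; by uniqueness at \<open>v\<close> it would be \<open>C\<close>, which
    passes through \<open>w\<close>.\<close>
  have sink: "\<exists>s. s \<in> V \<and> s \<noteq> v \<and> s \<noteq> w \<and> {u. N s u} \<subseteq> {v, w}"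
    if v: "v \<in> V" and C: "cycles C" "v \<notin> l ` C" "w \<in> l ` C" for v w C
  proof (rule ccontr)
    let ?S = "V - {v, w}"
    assume "\<not> ?thesis"
    then have "\<forall>s \<in> ?S. \<exists>e. e \<in> E \<and> l e = s \<and> h e \<in> ?S"
      using hV unfolding N_def by fast
    then obtain g where g: "\<And>s. s \<in> ?S \<Longrightarrow> g s \<in> E \<and> l (g s) = s \<and> h (g s) \<in> ?S"
      by metis
    have "?S \<noteq> {}" using vertex_outside[of v w] by auto
    then obtain C' where C': "C' \<subseteq> g ` ?S" "cycles C'"
      using closed_choice_cycles[of ?S g] g by blast
    have "v \<notin> l ` C'" "w \<notin> l ` C'" using C'(1) g by fastforce+
    then show False using avoiding_unique[OF v C(1,2) C'(2)] C(3) by blast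
  qed
  obtain v where v: "v \<in> V" using card_V by fastforce
  show d: "d = 2"
  proof -
    obtain C where C: "cycles C" "v \<notin> l ` C" using avoiding[OF v] by blast
    then obtain w where "w \<in> l ` C" by (auto simp: cycles_def)
    then obtain s where s: "s \<in> V" "{u. N s u} \<subseteq> {v, w}" using sink[OF v C] by blast
    then have "d \<le> card {v, w}" using succ(2)[OF s(1)] card_mono[OF _ s(2)] by simp
    also have "\<dots> \<le> 2" by (simp add: card_insert_if)
    finally show ?thesis using degree_ge_2 by simp
  qed
  \<comment> \<open>With \<open>d = 2\<close> the successors of the sink fill \<open>{v, w}\<close>,
    so for fixed \<open>v\<close> the sink determines \<open>w\<close>.\<close>
  have sink2: "\<exists>s. s \<in> V \<and> s \<noteq> v \<and> s \<noteq> w \<and> {u. N s u} = {v, w}"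
    if v: "v \<in> V" and C: "cycles C" "v \<notin> l ` C" "w \<in> l ` C" for v w C
  proof -
    obtain s where s: "s \<in> V" "s \<noteq> v" "s \<noteq> w" "{u. N s u} \<subseteq> {v, w}"
      using sink[OF v C] by blast
    have "card {v, w} \<le> card {u. N s u}" using succ(2)[OF s(1)] d by (simp add: card_insert_if)
    then have "{u. N s u} = {v, w}" using s(4) by (intro card_seteq) auto
    then show ?thesis using s by blast
  qed
  have digon: "\<exists>w w'. w \<noteq> w' \<and> w \<noteq> v \<and> w' \<noteq> v \<and> N w w' \<and> N w' w \<and>
      (\<exists>s. s \<noteq> v \<and> s \<noteq> w \<and> {u. N s u} = {v, w}) \<and>
      (\<exists>s. s \<noteq> v \<and> s \<noteq> w' \<and> {u. N s u} = {v, w'})" if v: "v \<in> V" for v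
  proof -
    obtain C where C: "cycles C" "v \<notin> l ` C" using avoiding[OF v] by blast
    then obtain s where s: "\<And>w. w \<in> l ` C \<Longrightarrow> s w \<noteq> v \<and> s w \<noteq> w \<and> {u. N (s w) u} = {v, w}"
      using sink2[OF v C] by metis
    \<comment> \<open>Sinks for different \<open>w\<close> are different predecessors of
      \<open>v\<close>, of which there are only two; hence \<open>C\<close> has at most two
      vertices.\<close>
    have "inj_on s (l ` C)" using s C(2) by (intro inj_onI) (metis insert_iff singletonD)
    moreover have "s ` l ` C \<subseteq> {u. N u v}" using s by auto
    ultimately have le: "card (l ` C) \<le> 2"
      using pred[OF v] d by (metis card_image card_mono)
    have CE: "C \<subseteq> E" "l ` C = h ` C" "C \<noteq> {}" using C by (auto simp: cycles_def)
    obtain e where e: "e \<in> C" using CE by auto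
    have ne: "l e \<noteq> h e" using e CE no_loop by auto
    have sub: "{l e, h e} \<subseteq> l ` C" using e CE by auto
    have "finite (l ` C)" using CE finE finite_subset by blast
    then have eq: "l ` C = {l e, h e}" using sub ne le by (intro card_seteq[symmetric]) auto
    have "h e \<in> l ` C" using eq by simp
    then obtain f where f: "f \<in> C" "l f = h e" by auto
    have "h f \<in> l ` C" "l f \<noteq> h f" using f CE no_loop[of f] by auto
    then have "h f = l e" using eq f by simp
    then have "N (l e) (h e)" "N (h e) (l e)" using e f CE by (auto simp: N_def)
    moreover have "l e \<noteq> v" "h e \<noteq> v" using C(2) eq by auto
    ultimately show ?thesis using ne s[of "l e"] s[of "h e"] eq by blast
  qed
  have digon_unique: "{a, b} = {a', b'}"
    if ab: "N a b" "N b a" and ab': "N a' b'" "N b' a'"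
      and u: "u \<in> V" "u \<notin> {a, b}" "u \<notin> {a', b'}" for a b a' b' u
  proof -
    have ex: "\<exists>C. cycles C \<and> l ` C = {a, b}" if N: "N a b" "N b a" for a b
    proof -
      obtain e f where "e \<in> E" "l e = a" "h e = b" "f \<in> E" "l f = b" "h f = a"
        using N by (auto simp: N_def)
      moreover have "a \<noteq> b" using N NV by blast
      ultimately have "cycles {e, f} \<and> l ` {e, f} = {a, b}" by (auto simp: cycles_def)
      then show ?thesis by blast
    qed
    show ?thesis using ex[OF ab] ex[OF ab'] u avoiding_unique by metis
  qed
  \<comment> \<open>The triangle \<open>x\<close>, \<open>y\<close>, \<open>z\<close> and the digon
    \<open>x\<close>, \<open>z\<close> would be two cycle sets avoiding \<open>u\<close>.\<close>
  have no_triangle: False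
    if N: "N x y" "N y z" "N z x" "N x z" and u: "u \<in> V" "u \<notin> {x, y, z}" for x y z u
  proof -
    obtain e f g e' where e: "e \<in> E" "l e = x" "h e = y" "f \<in> E" "l f = y" "h f = z"
      "g \<in> E" "l g = z" "h g = x" "e' \<in> E" "l e' = x" "h e' = z"
      using N by (auto simp: N_def)
    have ne: "x \<noteq> y" "y \<noteq> z" "z \<noteq> x" using N NV by blast+
    have "cycles {e, f, g}" "cycles {e', g}" using e ne by (auto simp: cycles_def)
    moreover have "u \<notin> l ` {e, f, g}" "u \<notin> l ` {e', g}" using e u by auto
    ultimately have "{e, f, g} = {e', g}" using avoiding_unique u(1) by blast
    then have "f \<in> {e', g}" by blast
    then show False using e ne by auto
  qed
  show "card V = 3"
  proof (rule ccontr)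
    assume "card V \<noteq> 3"
    have outside: "\<exists>u \<in> V. u \<notin> {a, b, c}" for a b c
    proof (rule ccontr)
      assume "\<not> ?thesis"
      then have "V \<subseteq> {a, b, c}" by auto
      then have "card V \<le> card {a, b, c}" by (intro card_mono) auto
      also have "\<dots> \<le> 3" by (simp add: card_insert_if)
      finally show False using card_V \<open>card V \<noteq> 3\<close> by simp
    qed
    obtain a b where ab: "N a b" "N b a" using digon[OF v] by blast
    have nab: "a \<noteq> b" "a \<in> V" "b \<in> V" using ab NV by blast+
    obtain c c' where cd: "N c c'" "N c' c" "c \<noteq> a" "c' \<noteq> a"
      using digon[OF nab(2)] by (elim exE conjE) (rule that)
    have ncd: "c \<noteq> c'" "c \<in> V" "c' \<in> V" using cd NV by blast+
    \<comment> \<open>Were \<open>b\<close> shared, the two digons would span three vertices and a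
      fourth would be avoided by both, making them equal although only one contains
      \<open>a\<close>.\<close>
    have cdb: "c \<noteq> b" "c' \<noteq> b"
    proof -
      obtain u where u: "u \<in> V" "u \<notin> {a, b, c}" using outside by blast
      show "c' \<noteq> b"
      proof
        assume "c' = b"
        then have "{a, b} = {c, c'}" using u by (intro digon_unique[OF ab cd(1,2)]) auto
        then show False using cd(3,4) by blast
      qed
      obtain u where u: "u \<in> V" "u \<notin> {a, b, c'}" using outside by blast
      show "c \<noteq> b"
      proof
        assume "c = b"
        then have "{a, b} = {c, c'}" using u by (intro digon_unique[OF ab cd(1,2)]) auto
        then show False using cd(3,4) by blast
      qed
    qed
    \<comment> \<open>A further vertex would again be avoided by both digons, so they exhaust
      \<open>V\<close>.\<close>
    have V: "x \<in> {a, b, c, c'}" if x: "x \<in> V" for x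
    proof (rule ccontr)
      assume "x \<notin> {a, b, c, c'}"
      then have "{a, b} = {c, c'}" using x by (intro digon_unique[OF ab cd(1,2)]) auto
      then show False using cd(3,4) by blast
    qed
    \<comment> \<open>The digon that avoids \<open>x\<close> can only be the one on \<open>a\<close>
      and \<open>b\<close>, and the sinks recorded in \<open>digon\<close> supply the required
      vertex for either choice of \<open>w\<close>.\<close>
    have hub: "\<exists>s \<in> {a, b, c, c'} - {x, w}. {u. N s u} = {x, w}"
      if x: "x \<in> {c, c'}" and w: "w \<in> {a, b}" for x w
    proof -
      have "x \<in> V" using x ncd by auto
      obtain p q where pq: "p \<noteq> q \<and> p \<noteq> x \<and> q \<noteq> x \<and> N p q \<and> N q p \<and>
          (\<exists>s. s \<noteq> x \<and> s \<noteq> p \<and> {u. N s u} = {x, p}) \<and>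
          (\<exists>s. s \<noteq> x \<and> s \<noteq> q \<and> {u. N s u} = {x, q})"
        using digon[OF \<open>x \<in> V\<close>] by (elim exE) (rule that)
      have "x \<notin> {p, q}" "x \<notin> {a, b}" using pq x cd(3,4) cdb by auto
      then have "{p, q} = {a, b}" using pq ab \<open>x \<in> V\<close> by (intro digon_unique) auto
      then have "w = p \<or> w = q" using w by (auto simp: doubleton_eq_iff)
      then obtain s where s: "s \<noteq> x" "s \<noteq> w" "{u. N s u} = {x, w}"
        using pq by (elim disjE) blast+
      then have "s \<in> V" using NV by blast
      then show ?thesis using s V by blast
    qed
    note ne = nab(1) cd(3,4) cdb ncd(1)
    \<comment> \<open>A vertex has only one successor set, so deciding between the candidates in
      \<open>ca\<close> settles others as well. Both decisions create a triangle through
      \<open>c\<close>, \<open>c'\<close> and \<open>a\<close> that avoids \<open>b\<close>.\<close>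
    have ca: "{u. N b u} = {c, a} \<or> {u. N c' u} = {c, a}" using hub[of c a] by auto
    have cb: "{u. N a u} = {c, b} \<or> {u. N c' u} = {c, b}" using hub[of c b] by auto
    have da: "{u. N b u} = {c', a} \<or> {u. N c u} = {c', a}" using hub[of c' a] by auto
    have db: "{u. N a u} = {c', b} \<or> {u. N c u} = {c', b}" using hub[of c' b] by auto
    from ca show False
    proof
      assume b: "{u. N b u} = {c, a}"
      then have c: "{u. N c u} = {c', a}" using da ne by (auto simp: doubleton_eq_iff)
      then have a: "{u. N a u} = {c', b}" using db ne by (auto simp: doubleton_eq_iff)
      have "N c a" "N a c'" using a c by blast+
      then show False using no_triangle[of c a c' b] cd nab cdb by auto
    next
      assume c'_succ: "{u. N c' u} = {c, a}"
      then have a: "{u. N a u} = {c, b}" using cb ne by (auto simp: doubleton_eq_iff)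
      have "N c' a" "N a c" using a c'_succ by blast+
      then show False using no_triangle[of c' a c b] cd nab cdb by auto
    qed
  qed
qed

end

section \<open>Contracting a perfect matching\<close>

locale bipartite_multigraph =
  fixes A :: "'a set" and B :: "'b set" and E :: "'e set" and l :: "'e \<Rightarrow> 'a" and r :: "'e \<Rightarrow> 'b"
  assumes finA: "finite A" and finB: "finite B" and finE: "finite E"
    and lA: "e \<in> E \<Longrightarrow> l e \<in> A" and rB: "e \<in> E \<Longrightarrow> r e \<in> B"
begin

text \<open>The two-sided form of \<open>perfect_matching\<close>, linked to it by
  \<open>perfect_matching_iff\<close>; in this form \<open>M\<close> identifies \<open>B\<close>
  with \<open>A\<close>.\<close>

definition matching :: "'e set \<Rightarrow> bool" where
  "matching M \<longleftrightarrow> M \<subseteq> E \<and> bij_betw l M A \<and> bij_betw r M B"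

text \<open>Contracting \<open>M\<close> turns \<open>e\<close> into an arc from \<open>l e\<close> to \<open>head M e\<close>.\<close>

definition head :: "'e set \<Rightarrow> 'e \<Rightarrow> 'a" where
  "head M e = l (inv_into M r (r e))"

lemma matching_finite: "finite {M. matching M}"
  by (rule finite_subset[of _ "Pow E"]) (auto simp: matching_def finE)

lemma inv_into_matching:
  assumes "matching M" "e \<in> E"
  shows "inv_into M r (r e) \<in> M" "r (inv_into M r (r e)) = r e"
proof -
  have "r e \<in> r ` M" using assms rB by (auto simp: matching_def bij_betw_def)
  then show "inv_into M r (r e) \<in> M" "r (inv_into M r (r e)) = r e"
    by (rule inv_into_into, rule f_inv_into_f)
qed

lemma head_eq:
  assumes "matching M" "e \<in> E" "m \<in> M"
  shows "head M e = l m \<longleftrightarrow> r e = r m"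
proof -
  have "inj_on l M" "inj_on r M" using assms by (auto simp: matching_def bij_betw_def)
  then show ?thesis using inv_into_matching[OF assms(1,2)] assms(3)
    unfolding head_def by (metis inj_onD)
qed

lemma head_in: "matching M \<Longrightarrow> e \<in> E \<Longrightarrow> head M e \<in> A"
  using inv_into_matching(1)[of M e] lA by (auto simp: head_def matching_def)

lemma arc_system_diff: "matching M \<Longrightarrow> arc_system A (E - M) l (head M)"
  using finA finE lA head_in by unfold_locales auto

lemma head_eq_iff:
  assumes M: "matching M" and e: "e \<in> E" "e' \<in> E"
  shows "head M e = head M e' \<longleftrightarrow> r e = r e'"
  using head_eq[OF M e(1) inv_into_matching(1)[OF M e(2)]] inv_into_matching(2)[OF M e(2)]
  by (simp add: head_def)

text \<open>Heads and tails of \<open>C\<close> are the same vertices, so the right ends of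
  \<open>C\<close> are exactly the \<open>M\<close>-partners of its left ends. Exchanging the edges
  of \<open>M\<close> there for \<open>C\<close> neither doubles nor loses a vertex.\<close>

lemma matching_switch:
  assumes M: "matching M" and C: "arc_system.cycles (E - M) l (head M) C"
  shows "matching (C \<union> {m \<in> M. l m \<notin> l ` C})"
proof -
  have C': "C \<subseteq> E - M" "inj_on l C" "inj_on (head M) C" "l ` C = head M ` C"
    using C by (auto simp: arc_system.cycles_def[OF arc_system_diff[OF M]])
  have M': "M \<subseteq> E" "inj_on l M" "l ` M = A" "inj_on r M" "r ` M = B"
    using M by (auto simp: matching_def bij_betw_def)
  let ?R = "{m \<in> M. l m \<notin> l ` C}"
  have hr: "head M e = head M e' \<longleftrightarrow> r e = r e'" if "e \<in> C" "e' \<in> C" for e e'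
    using that C' head_eq_iff[OF M] by blast
  have hm: "head M e = l m \<longleftrightarrow> r e = r m" if "e \<in> C" "m \<in> M" for e m
    using that C' head_eq[OF M] by blast
  have "inj_on r C" using C'(3) hr by (auto simp: inj_on_def)
  moreover have "inj_on r ?R" using M' by (auto intro: inj_on_subset)
  moreover have "r e \<noteq> r m" if "e \<in> C" "m \<in> ?R" for e m
    using that hm[of e m] C'(4) by force
  ultimately have "inj_on r (C \<union> ?R)"
    unfolding inj_on_Un by blast
  moreover have "inj_on l (C \<union> ?R)"
  proof -
    have "inj_on l ?R" by (rule inj_on_subset[OF M'(2)]) auto
    moreover have "l x \<noteq> l m" if "x \<in> C" "m \<in> ?R" for x m
      using that imageI[OF that(1), of l] by (metis (mono_tags, lifting) mem_Collect_eq)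
    ultimately show ?thesis using C'(2) unfolding inj_on_Un by blast
  qed
  moreover have "l ` (C \<union> ?R) = A"
  proof -
    have "l ` C \<subseteq> A" using C'(1) lA by auto
    moreover have "l ` ?R = A - l ` C" unfolding M'(3)[symmetric] by auto
    ultimately show ?thesis unfolding image_Un by blast
  qed
  moreover have "r ` (C \<union> ?R) = B"
  proof
    show "r ` (C \<union> ?R) \<subseteq> B" using C' M' rB by auto
    show "B \<subseteq> r ` (C \<union> ?R)"
    proof
      fix b assume "b \<in> B"
      then obtain m where m: "m \<in> M" "r m = b" using M' by auto
      show "b \<in> r ` (C \<union> ?R)"
      proof (cases "l m \<in> l ` C")
        case True
        then obtain e where "e \<in> C" "head M e = l m" using C'(4) by auto
        then show ?thesis using hm m by auto
      qed (use m in auto)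
    qed
  qed
  ultimately show ?thesis using C' M' by (auto simp: matching_def bij_betw_def)
qed

text \<open>The inverse of switching. Both \<open>l\<close> and \<open>head M\<close> map
  \<open>N\<close> bijectively onto \<open>A\<close> and they agree on \<open>M\<close>, so deleting
  \<open>N \<inter> M\<close> removes the same vertices from both images.\<close>

lemma matching_diff_cycles:
  assumes M: "matching M" and N: "matching N" "N \<noteq> M"
  shows "arc_system.cycles (E - M) l (head M) (N - M)"
    and "m \<in> M \<Longrightarrow> m \<in> N \<Longrightarrow> l m \<notin> l ` (N - M)"
proof -
  have M': "M \<subseteq> E" "inj_on l M" "l ` M = A" "inj_on r M" "r ` M = B"
    using M by (auto simp: matching_def bij_betw_def)
  have N': "N \<subseteq> E" "inj_on l N" "l ` N = A" "inj_on r N" "r ` N = B"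
    using N by (auto simp: matching_def bij_betw_def)
  have inj: "inj_on (head M) N"
    using N' head_eq_iff[OF M] by (auto simp: inj_on_def subset_iff)
  have headM: "head M m = l m" if "m \<in> M" for m
    using head_eq[OF M, of m m] that M' by auto
  have "head M ` N = A"
  proof
    show "head M ` N \<subseteq> A" using N' head_in[OF M] by auto
    show "A \<subseteq> head M ` N"
    proof
      fix a assume "a \<in> A"
      then obtain m where m: "m \<in> M" "l m = a" using M' by auto
      then have "r m \<in> r ` N" using M' N' by auto
      then obtain e where e: "e \<in> N" "r e = r m" by auto
      then have "head M e = a" using head_eq[OF M _ m(1), of e] N' m by auto
      then show "a \<in> head M ` N" using e by auto
    qed
  qed
  moreover have NM: "N - N \<inter> M = N - M" by blast
  ultimately have hd: "head M ` (N - M) = A - l ` (N \<inter> M)"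
    using inj_on_image_set_diff[OF inj, of N "N \<inter> M"] headM by simp
  have ld: "l ` (N - M) = A - l ` (N \<inter> M)"
    using inj_on_image_set_diff[OF N'(2), of N "N \<inter> M"] N' NM by simp
  \<comment> \<open>\<open>N\<close> has an edge at each left vertex and \<open>M\<close> only one
    there, so \<open>N \<subseteq> M\<close> would mean \<open>N = M\<close>.\<close>
  have "N - M \<noteq> {}"
  proof
    assume "N - M = {}"
    then have "N \<subseteq> M" by auto
    moreover have "M \<subseteq> N"
    proof
      fix m assume m: "m \<in> M"
      then obtain n where "n \<in> N" "l n = l m" using M' N' by (metis imageE imageI)
      then show "m \<in> N" using m M' \<open>N \<subseteq> M\<close> by (metis inj_onD subsetD)
    qed
    ultimately show False using N(2) by auto
  qed
  then show "arc_system.cycles (E - M) l (head M) (N - M)"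
    using hd ld N' inj
    by (auto simp: arc_system.cycles_def[OF arc_system_diff[OF M]] intro: inj_on_subset)
  show "l m \<notin> l ` (N - M)" if "m \<in> M" "m \<in> N" using that ld by auto
qed

section \<open>Counting perfect matchings\<close>

text \<open>Double counting of pairs of a matching and its edge at \<open>v\<close>. Taking
  \<open>l\<close> or \<open>r\<close> for \<open>f\<close> serves both sides, and since the number
  of matchings does not depend on \<open>v\<close>, the graph is regular.\<close>

lemma degree_count:
  assumes f: "\<And>M. matching M \<Longrightarrow> \<exists>!e. e \<in> M \<and> f e = v"
    and two: "\<And>e. e \<in> E \<Longrightarrow> card {M. matching M \<and> e \<in> M} = 2"
  shows "card {M. matching M} = 2 * card {e \<in> E. f e = v}"
proof -
  have "{M. matching M} = (\<Union>e \<in> {e \<in> E. f e = v}. {M. matching M \<and> e \<in> M})"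
  proof (intro equalityI subsetI)
    fix M assume M: "M \<in> {M. matching M}"
    then obtain e where "e \<in> M" "f e = v" using f by blast
    then show "M \<in> (\<Union>e \<in> {e \<in> E. f e = v}. {M. matching M \<and> e \<in> M})"
      using M unfolding matching_def by auto
  qed auto
  also have "card \<dots> = (\<Sum>e \<in> {e \<in> E. f e = v}. card {M. matching M \<and> e \<in> M})"
  proof (rule card_UN_disjoint)
    show "\<forall>e \<in> {e \<in> E. f e = v}. finite {M. matching M \<and> e \<in> M}"
      using matching_finite by (auto intro: rev_finite_subset)
    show "\<forall>e \<in> {e \<in> E. f e = v}. \<forall>e' \<in> {e \<in> E. f e = v}. e \<noteq> e' \<longrightarrow>
        {M. matching M \<and> e \<in> M} \<inter> {M. matching M \<and> e' \<in> M} = {}"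
      using f by blast
  qed (simp add: finE)
  finally show ?thesis using two by simp
qed

text \<open>Once \<open>e\<close> is chosen only \<open>a'\<close> and \<open>b'\<close> remain, and
  any edge between them completes the matching. The equation serves both directions of the
  theorem.\<close>

lemma card_matchings_through:
  assumes A: "A = {a, a'}" "a \<noteq> a'" and B: "B = {b, b'}" "b \<noteq> b'"
    and e: "e \<in> E" "l e = a" "r e = b"
  shows "card {M. matching M \<and> e \<in> M} = card {f \<in> E. l f = a' \<and> r f = b'}"
proof -
  let ?F = "{f \<in> E. l f = a' \<and> r f = b'}"
  have "{M. matching M \<and> e \<in> M} = (\<lambda>f. {e, f}) ` ?F"
  proof (intro equalityI subsetI)
    fix M assume "M \<in> {M. matching M \<and> e \<in> M}"
    then have M: "M \<subseteq> E" "inj_on l M" "l ` M = A" "inj_on r M" "e \<in> M"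
      by (auto simp: matching_def bij_betw_def)
    then obtain f where f: "f \<in> M" "l f = a'" using A by (metis imageE insertCI)
    then have "r f \<noteq> b" using M e A by (auto simp: inj_on_def)
    then have "f \<in> ?F" using f M rB B by auto
    moreover have "x = e \<or> x = f" if "x \<in> M" for x
      using that M f e A lA[of x] by (auto simp: inj_on_def)
    then have "M = {e, f}" using M f by blast
    ultimately show "M \<in> (\<lambda>f. {e, f}) ` ?F" by blast
  next
    fix M assume "M \<in> (\<lambda>f. {e, f}) ` ?F"
    then obtain f where f: "M = {e, f}" "f \<in> E" "l f = a'" "r f = b'" by auto
    then have "bij_betw l M A" "bij_betw r M B"
      unfolding A(1) B(1) bij_betw_def using e A(2) B(2) by (auto simp: inj_on_def)
    then show "M \<in> {M. matching M \<and> e \<in> M}" using e f by (simp add: matching_def)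
  qed
  moreover have "inj_on (\<lambda>f. {e, f}) ?F"
    using e A by (auto simp: inj_on_def doubleton_eq_iff)
  ultimately show ?thesis by (simp add: card_image)
qed

text \<open>Removing the ends of \<open>e\<close> leaves a 4-cycle, whose two perfect matchings
  complete \<open>e\<close>.\<close>

lemma card_matchings_through_simple:
  assumes card: "card A = 3" "card B = 3"
    and simple: "\<And>a b. a \<in> A \<Longrightarrow> b \<in> B \<Longrightarrow> card {f \<in> E. l f = a \<and> r f = b} = 1"
    and e: "e \<in> E"
  shows "card {M. matching M \<and> e \<in> M} = 2"
proof -
  define a b where ab: "a = l e" "b = r e"
  have "card (A - {a}) = 2" "card (B - {b}) = 2"
    using card lA[OF e] rB[OF e] by (simp_all add: ab)
  then obtain p q s t where "A - {a} = {p, q}" "p \<noteq> q" and "B - {b} = {s, t}" "s \<noteq> t"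
    by (meson card_2_iff)
  then have A: "A = {a, p, q}" "distinct [a, p, q]" and B: "B = {b, s, t}" "distinct [b, s, t]"
    using lA[OF e] rB[OF e] ab by auto
  have "\<exists>x. x \<in> E \<and> l x = u \<and> r x = v" if "u \<in> A" "v \<in> B" for u v
    using simple[OF that] by (auto simp: card_1_singleton_iff)
  then obtain x where x: "\<And>u v. u \<in> A \<Longrightarrow> v \<in> B \<Longrightarrow> x u v \<in> E \<and> l (x u v) = u \<and> r (x u v) = v"
    by metis
  have unique: "f = x (l f) (r f)" if "f \<in> E" for f
  proof -
    let ?D = "{g \<in> E. l g = l f \<and> r g = r f}"
    have "card ?D = 1" using simple[of "l f" "r f"] lA rB that by simp
    then obtain y where "?D = {y}" by (rule card_1_singletonE)
    moreover have "f \<in> ?D" "x (l f) (r f) \<in> ?D"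
      using that x[of "l f" "r f"] lA rB by auto
    ultimately show ?thesis by (metis singletonD)
  qed
  have xs: "x a b = e" "x p s \<in> E" "l (x p s) = p" "r (x p s) = s"
    "x p t \<in> E" "l (x p t) = p" "r (x p t) = t" "x q s \<in> E" "l (x q s) = q" "r (x q s) = s"
    "x q t \<in> E" "l (x q t) = q" "r (x q t) = t"
    using x unique[OF e] A(1) B(1) by (simp_all add: ab)
  let ?M = "{e, x p s, x q t}" and ?N = "{e, x p t, x q s}"
  have "{M. matching M \<and> e \<in> M} = {?M, ?N}"
  proof (intro equalityI subsetI)
    fix M assume "M \<in> {M. matching M \<and> e \<in> M}"
    then have M: "M \<subseteq> E" "inj_on l M" "l ` M = A" "inj_on r M" "e \<in> M"
      by (auto simp: matching_def bij_betw_def)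
    have "p \<in> l ` M" "q \<in> l ` M" using M A by auto
    then obtain f g where f: "f \<in> M" "l f = p" and g: "g \<in> M" "l g = q" by auto
    have "r f \<noteq> b" "r g \<noteq> b" "r f \<noteq> r g"
      using inj_onD[OF M(4)] f g M(5) A(2) ab by fastforce+
    moreover have "r f \<in> B" "r g \<in> B" using f g M(1) rB by auto
    ultimately have "r f = s \<and> r g = t \<or> r f = t \<and> r g = s" using B by auto
    moreover have "f = x p (r f)" "g = x q (r g)" using unique f g M(1) by blast+
    moreover have "y = e \<or> y = f \<or> y = g" if "y \<in> M" for y
    proof -
      have "l y \<in> {a, p, q}" using that M(3) A(1) by auto
      then show ?thesis using inj_onD[OF M(2)] that f g M(5) ab by auto
    qed
    then have "M = {e, f, g}" using M(5) f g by blast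
    ultimately show "M \<in> {?M, ?N}" by auto
  next
    fix M assume "M \<in> {?M, ?N}"
    then consider "M = ?M" | "M = ?N" by blast
    then have "bij_betw l M A \<and> bij_betw r M B"
      unfolding A(1) B(1) bij_betw_def using A(2) B(2) xs ab
      by cases (auto simp: inj_on_def)
    then show "M \<in> {M. matching M \<and> e \<in> M}"
      using \<open>M \<in> {?M, ?N}\<close> e xs by (auto simp: matching_def)
  qed
  moreover have "?M \<noteq> ?N"
  proof
    assume "?M = ?N"
    then have "x p s \<in> ?N" by blast
    then show False using xs ab A(2) B(2) by auto
  qed
  ultimately show ?thesis by simp
qed

end

section \<open>Edge multiplicities of double covered bipartite graphs\<close>

text \<open>Connectedness enters as a statement on cuts, because contraction turns such a cut into
  the one required by \<open>weakly_connected\<close>.\<close>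

locale double_covered_bipartite = bipartite_multigraph A B E l r
  for A :: "'a set" and B :: "'b set" and E :: "'e set" and l :: "'e \<Rightarrow> 'a" and r :: "'e \<Rightarrow> 'b" +
  assumes nonempty: "E \<noteq> {}"
    and two: "e \<in> E \<Longrightarrow> card {M. matching M \<and> e \<in> M} = 2"
    and connected: "\<lbrakk>S \<subseteq> A; T \<subseteq> B; \<And>e. e \<in> E \<Longrightarrow> l e \<in> S \<longleftrightarrow> r e \<in> T\<rbrakk>
      \<Longrightarrow> S = {} \<and> T = {} \<or> S = A \<and> T = B"
begin

lemma edge_in_matching: "e \<in> E \<Longrightarrow> \<exists>M. matching M \<and> e \<in> M"
  using two[of e] by (metis (mono_tags, lifting) Collect_empty_eq card.empty zero_neq_numeral)

lemma exists_other_matching: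
  assumes "matching M" "e \<in> M" shows "\<exists>N. matching N \<and> e \<in> N \<and> N \<noteq> M"
proof (rule ccontr)
  assume "\<not> ?thesis"
  then have "{N. matching N \<and> e \<in> N} = {M}" using assms by blast
  then show False using two[of e] assms by (auto simp: matching_def)
qed

lemma other_matching_unique:
  assumes "matching M" "e \<in> M" "matching N" "e \<in> N" "N \<noteq> M" "matching N'" "e \<in> N'" "N' \<noteq> M"
  shows "N = N'"
proof (rule ccontr)
  assume "N \<noteq> N'"
  have "{M, N, N'} \<subseteq> {N. matching N \<and> e \<in> N}" using assms by blast
  moreover have "finite {N. matching N \<and> e \<in> N}"
    using matching_finite by (auto intro: rev_finite_subset)
  ultimately have "card {M, N, N'} \<le> 2"
    using two[of e] assms by (metis (no_types, lifting) card_mono matching_def subsetD)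
  then show False using assms \<open>N \<noteq> N'\<close> by auto
qed

text \<open>By \<open>degree_count\<close> the number of perfect matchings is twice the degree of
  any vertex, hence the halving.\<close>

definition degree :: nat where "degree = card {M. matching M} div 2"

lemma left_degree:
  assumes "a \<in> A" shows "card {e \<in> E. l e = a} = degree"
proof -
  have "\<exists>!e. e \<in> M \<and> l e = a" if "matching M" for M
    using that assms unfolding matching_def bij_betw_def inj_on_def by (metis (no_types) imageE)
  then show ?thesis using degree_count[of l a] two by (simp add: degree_def)
qed

lemma right_degree:
  assumes "b \<in> B" shows "card {e \<in> E. r e = b} = degree"
proof -
  have "\<exists>!e. e \<in> M \<and> r e = b" if "matching M" for M
    using that assms unfolding matching_def bij_betw_def inj_on_def by (metis (no_types) imageE)
  then show ?thesis using degree_count[of r b] two by (simp add: degree_def)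
qed

text \<open>Switching and its inverse match the cycle sets avoiding \<open>l m\<close>, for
  \<open>m\<close> in \<open>M\<close>, with the perfect matchings through \<open>m\<close> other
  than \<open>M\<close>; double covering provides exactly one of these.\<close>

lemma unique_cycles:
  assumes M: "matching M" and card: "card A \<ge> 3"
  shows "unique_cycles A (E - M) l (head M) (degree - 1)"
proof -
  interpret arc_system A "E - M" l "head M" using arc_system_diff[OF M] .
  have M': "M \<subseteq> E" "inj_on l M" "l ` M = A" "inj_on r M" "r ` M = B"
    using M by (auto simp: matching_def bij_betw_def)
  show ?thesis
  proof
    fix v assume "v \<in> A"
    then obtain m where m: "m \<in> M" "l m = v" using M' by auto
    have deg: "card (X - {m}) = card X - 1" if "m \<in> X" for X
      using that by simp
    obtain N where "matching N" "m \<in> N" "N \<noteq> M" using exists_other_matching[OF M m(1)] by blast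
    then show "\<exists>C. cycles C \<and> v \<notin> l ` C" using matching_diff_cycles[OF M] m by blast
    have "{e \<in> E - M. l e = v} = {e \<in> E. l e = v} - {m}"
      using m M' by (auto simp: inj_on_def)
    then show "card {e \<in> E - M. l e = v} = degree - 1"
      using left_degree[OF \<open>v \<in> A\<close>] m M' deg[of "{e \<in> E. l e = v}"] by auto
    \<comment> \<open>An arc has head \<open>v\<close> exactly when it shares its right end with
      \<open>m\<close>, so the indegree is the degree of that right vertex without
      \<open>m\<close>.\<close>
    have "{e \<in> E - M. head M e = v} = {e \<in> E. r e = r m} - {m}"
      using m M' head_eq[OF M _ m(1)] by (auto simp: inj_on_def)
    then show "card {e \<in> E - M. head M e = v} = degree - 1"
      using right_degree[of "r m"] m M' deg[of "{e \<in> E. r e = r m}"] rB by auto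
  next
    fix v C C'
    assume v: "v \<in> A" and C: "cycles C" "v \<notin> l ` C" "cycles C'" "v \<notin> l ` C'"
    obtain m where m: "m \<in> M" "l m = v" using M' v by auto
    \<comment> \<open>\<open>?P C\<close> is \<open>M\<close> switched along \<open>C\<close>. As
      \<open>C\<close> is recovered as \<open>?P C - M\<close>, uniqueness of the second matching
      through \<open>m\<close> transfers to \<open>C\<close>.\<close>
    let ?P = "\<lambda>C. C \<union> {m \<in> M. l m \<notin> l ` C}"
    have P: "matching (?P C) \<and> m \<in> ?P C \<and> ?P C \<noteq> M \<and> C = ?P C - M"
      if "cycles C" "v \<notin> l ` C" for C
      using that matching_switch[OF M] m by (auto simp: cycles_def)
    note P1 = P[OF C(1,2)] and P2 = P[OF C(3,4)]
    have eq: "?P C = ?P C'"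
      by (rule other_matching_unique[OF M m(1)]) (use P1 P2 in blast)+
    have "C = ?P C - M" using P1 by blast
    also have "\<dots> = ?P C' - M" by (simp only: eq)
    also have "\<dots> = C'" using P2 by blast
    finally show "C = C'" .
  next
    fix S assume S: "S \<subseteq> A" "S \<noteq> {}" "S \<noteq> A"
    \<comment> \<open>\<open>T\<close> collects the \<open>M\<close>-partners of \<open>S\<close>,
      so an edge crosses the cut exactly when its arc crosses \<open>S\<close>. Edges of
      \<open>M\<close> never do, so the crossing edge survives contraction.\<close>
    define T where "T = r ` {m \<in> M. l m \<in> S}"
    have T: "r e \<in> T \<longleftrightarrow> head M e \<in> S" if "e \<in> E" for e
    proof
      assume "r e \<in> T"
      then obtain m where m: "m \<in> M" "l m \<in> S" "r e = r m" by (auto simp: T_def)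
      then have "head M e = l m" using head_eq[OF M that m(1)] by simp
      then show "head M e \<in> S" using m by simp
    next
      assume "head M e \<in> S"
      then have "inv_into M r (r e) \<in> {m \<in> M. l m \<in> S}"
        using inv_into_matching(1)[OF M that] by (simp add: head_def)
      then show "r e \<in> T" using inv_into_matching(2)[OF M that] unfolding T_def by (metis imageI)
    qed
    have "T \<subseteq> B" using M' rB by (auto simp: T_def)
    have "\<not> (\<forall>e \<in> E. l e \<in> S \<longleftrightarrow> r e \<in> T)"
      using connected[OF S(1) \<open>T \<subseteq> B\<close>] S(2,3) by auto
    then obtain e where e: "e \<in> E" "(l e \<in> S) \<noteq> (r e \<in> T)" by blast
    then have "(l e \<in> S) \<noteq> (head M e \<in> S)" using T by simp
    moreover from this have "e \<notin> M" using head_eq[OF M e(1), of e] by auto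
    ultimately show "\<exists>e \<in> E - M. (l e \<in> S) \<noteq> (head M e \<in> S)" using e by blast
  qed (rule card)
qed

lemma card_sides: "card A = card B" "A \<noteq> {}"
proof -
  obtain e M where "e \<in> E" "matching M" using nonempty edge_in_matching by blast
  then show "card A = card B" "A \<noteq> {}"
    using bij_betw_same_card[of l M A] bij_betw_same_card[of r M B] lA by (auto simp: matching_def)
qed

text \<open>Contracting a matching through one of two parallel edges would turn the other into a
  loop, so the graph is simple. Then \<open>card_eq_3_if_simple\<close> gives degree 3, and the
  three neighbours of a left vertex are all of \<open>B\<close>.\<close>

lemma simple_if_card_ge_3:
  assumes card: "card A \<ge> 3"
  shows "card A = 3 \<and> card B = 3 \<and> (\<forall>a \<in> A. \<forall>b \<in> B. card {e \<in> E. l e = a \<and> r e = b} = 1)"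
proof -
  have simple: "e = e'" if e: "e \<in> E" "e' \<in> E" "l e = l e'" "r e = r e'" for e e'
  proof (rule ccontr)
    assume "e \<noteq> e'"
    obtain M where M: "matching M" "e \<in> M" using edge_in_matching[OF e(1)] by blast
    then interpret unique_cycles A "E - M" l "head M" "degree - 1" using unique_cycles card by blast
    have "e' \<notin> M" using M e \<open>e \<noteq> e'\<close> by (auto simp: matching_def bij_betw_def inj_on_def)
    then show False using no_loop[of e'] head_eq[OF M(1) e(2) M(2)] e by simp
  qed
  obtain M where M: "matching M" using nonempty edge_in_matching by blast
  then interpret unique_cycles A "E - M" l "head M" "degree - 1" using unique_cycles card by blast
  have "e = e'" if "e \<in> E - M" "e' \<in> E - M" "l e = l e'" "head M e = head M e'" for e e'
    using that simple head_eq_iff[OF M] by auto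
  then have A3: "card A = 3" and "degree - 1 = 2" using card_eq_3_if_simple by blast+
  then have deg: "degree = 3" by simp
  have "card {e \<in> E. l e = a \<and> r e = b} = 1" if a: "a \<in> A" and b: "b \<in> B" for a b
  proof -
    let ?D = "{e \<in> E. l e = a}"
    have "inj_on r ?D" using simple by (auto simp: inj_on_def)
    then have "card (r ` ?D) = 3" using left_degree[OF a] deg by (simp add: card_image)
    then have "r ` ?D = B" using rB finB card_sides A3 by (intro card_seteq) auto
    then obtain e where "e \<in> E" "l e = a" "r e = b" using b by auto
    then have "{e \<in> E. l e = a \<and> r e = b} = {e}" using simple by auto
    then show ?thesis by simp
  qed
  then show ?thesis using A3 card_sides by simp
qed

text \<open>With a single left vertex every perfect matching is one edge, so an edge would lie in
  only one of them.\<close>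

lemma card_A_neq_1: "card A \<noteq> 1"
proof
  assume "card A = 1"
  then obtain a where a: "A = {a}" by (auto simp: card_1_singleton_iff)
  obtain e where e: "e \<in> E" using nonempty by blast
  have "M = {e}" if "matching M" "e \<in> M" for M
  proof -
    have M: "M \<subseteq> E" "inj_on l M" using that by (auto simp: matching_def bij_betw_def)
    have "x = e" if "x \<in> M" for x
      using that M \<open>e \<in> M\<close> lA[of x] lA[of e] a by (auto simp: inj_on_def)
    then show ?thesis using \<open>e \<in> M\<close> by blast
  qed
  then show False using exists_other_matching edge_in_matching[OF e] by metis
qed

lemma opposite_edges:
  assumes A: "A = {a, a'}" "a \<noteq> a'" and B: "B = {b, b'}" "b \<noteq> b'"
    and ne: "{e \<in> E. l e = a \<and> r e = b} \<noteq> {}"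
  shows "card {e \<in> E. l e = a' \<and> r e = b'} = 2"
proof -
  obtain e where "e \<in> E" "l e = a" "r e = b" using ne by auto
  then show ?thesis using card_matchings_through[OF A B] two by simp
qed

lemma multiplicity_if_card_2:
  assumes card: "card A = 2"
  shows "card B = 2 \<and> (\<forall>a \<in> A. \<forall>b \<in> B. card {e \<in> E. l e = a \<and> r e = b} = 2)"
proof -
  have "card {e \<in> E. l e = a \<and> r e = b} = 2" if a: "a \<in> A" and b: "b \<in> B" for a b
  proof -
    obtain a' where A: "A = {a, a'}" "a \<noteq> a'" using card a by (auto simp: card_2_iff)
    obtain b' where B: "B = {b, b'}" "b \<noteq> b'" using card card_sides b by (auto simp: card_2_iff)
    \<comment> \<open>An edge crossing this cut joins \<open>a\<close> to \<open>b\<close> or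
      \<open>a'\<close> to \<open>b'\<close>. In the first case \<open>opposite_edges\<close>
      supplies an edge of the second kind; in both, the same lemma with the pairs exchanged then
      counts the edges between \<open>a\<close> and \<open>b\<close>.\<close>
    have "\<not> (\<forall>e \<in> E. l e \<in> {a} \<longleftrightarrow> r e \<in> {b'})"
      using connected[of "{a}" "{b'}"] A B by auto
    then obtain e where e: "e \<in> E" "(l e = a) \<noteq> (r e = b')" by auto
    then have "l e = a \<and> r e = b \<or> l e = a' \<and> r e = b'"
      using A B lA[of e] rB[of e] by auto
    then have "{e \<in> E. l e = a \<and> r e = b} \<noteq> {} \<or> {e \<in> E. l e = a' \<and> r e = b'} \<noteq> {}"
      using e by blast
    then have ne: "{e \<in> E. l e = a' \<and> r e = b'} \<noteq> {}"
      using opposite_edges[OF A B] by (metis card.empty zero_neq_numeral)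
    show ?thesis
      by (rule opposite_edges[OF _ _ _ _ ne]) (use A B in auto)
  qed
  then show ?thesis using card card_sides by simp
qed

theorem classification:
  "card A = 2 \<and> card B = 2 \<and> (\<forall>a \<in> A. \<forall>b \<in> B. card {e \<in> E. l e = a \<and> r e = b} = 2) \<or>
   card A = 3 \<and> card B = 3 \<and> (\<forall>a \<in> A. \<forall>b \<in> B. card {e \<in> E. l e = a \<and> r e = b} = 1)"
proof -
  have "card A \<noteq> 0" using card_sides(2) finA by simp
  then consider "card A = 2" | "card A \<ge> 3" using card_A_neq_1 by linarith
  then show ?thesis
  proof cases
    case 1
    then show ?thesis using multiplicity_if_card_2[OF 1] by (intro disjI1 conjI) simp_all
  next
    case 2
    then show ?thesis using simple_if_card_ge_3[OF 2] by (intro disjI2)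
  qed
qed

end

section \<open>Multigraphs with uniform edge multiplicities\<close>

lemma bij_betw_iff_ex1:
  assumes "f ` M \<subseteq> X"
  shows "bij_betw f M X \<longleftrightarrow> (\<forall>x \<in> X. \<exists>!e. e \<in> M \<and> f e = x)"
proof
  assume *: "bij_betw f M X"
  show "\<forall>x \<in> X. \<exists>!e. e \<in> M \<and> f e = x"
  proof
    fix x assume "x \<in> X"
    then obtain e where "e \<in> M" "f e = x" using * by (auto simp: bij_betw_def)
    then show "\<exists>!e. e \<in> M \<and> f e = x" using * by (auto simp: bij_betw_def inj_on_def)
  qed
next
  assume *: "\<forall>x \<in> X. \<exists>!e. e \<in> M \<and> f e = x"
  have "inj_on f M"
  proof (rule inj_onI)
    fix e e' assume "e \<in> M" "e' \<in> M" "f e = f e'"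
    moreover from this have "\<exists>!e''. e'' \<in> M \<and> f e'' = f e" using * assms by blast
    ultimately show "e = e'" by metis
  qed
  moreover have "X \<subseteq> f ` M"
  proof
    fix x assume "x \<in> X"
    then obtain e where "e \<in> M" "f e = x" using * by blast
    then show "x \<in> f ` M" by blast
  qed
  ultimately show "bij_betw f M X" using assms by (auto simp: bij_betw_def)
qed

section \<open>Bipartitions of a multigraph\<close>

locale bipartition =
  fixes G :: "('v, 'e) multigraph" and A B :: "'v set" and l r :: "'e \<Rightarrow> 'v"
  assumes verts: "verts G = A \<union> B" and disjoint: "A \<inter> B = {}"
    and fin: "finite (verts G)" "finite (edges G)"
    and lA: "e \<in> edges G \<Longrightarrow> l e \<in> A" and rB: "e \<in> edges G \<Longrightarrow> r e \<in> B"
    and ends: "e \<in> edges G \<Longrightarrow> ends G e = {l e, r e}"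
begin

sublocale bipartite_multigraph A B "edges G" l r
  using fin verts lA rB by unfold_locales auto

lemma perfect_matching_iff: "perfect_matching G M \<longleftrightarrow> matching M"
proof (cases "M \<subseteq> edges G")
  case True
  have "e \<in> M \<and> v \<in> ends G e \<longleftrightarrow> e \<in> M \<and> l e = v" if "v \<in> A" for e v
  proof (cases "e \<in> M")
    case e: True
    then have "ends G e = {l e, r e}" "r e \<in> B" using True ends rB by auto
    then show ?thesis using that disjoint by auto
  qed simp
  moreover have "e \<in> M \<and> v \<in> ends G e \<longleftrightarrow> e \<in> M \<and> r e = v" if "v \<in> B" for e v
  proof (cases "e \<in> M")
    case e: True
    then have "ends G e = {l e, r e}" "l e \<in> A" using True ends lA by auto
    then show ?thesis using that disjoint by auto
  qed simp
  moreover have "l ` M \<subseteq> A" "r ` M \<subseteq> B" using True lA rB by auto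
  ultimately show ?thesis
    using True by (simp add: perfect_matching_def matching_def verts ball_Un bij_betw_iff_ex1)
qed (simp add: perfect_matching_def matching_def)

text \<open>Adjacency never leaves \<open>S \<union> T\<close>, so if this set is nonempty, paths
  from one of its vertices reach everything inside it.\<close>

lemma connected_graph_closed:
  assumes conn: "connected_graph G" and S: "S \<subseteq> A" and T: "T \<subseteq> B"
    and closed: "\<And>e. e \<in> edges G \<Longrightarrow> l e \<in> S \<longleftrightarrow> r e \<in> T"
  shows "S = {} \<and> T = {} \<or> S = A \<and> T = B"
proof (cases "S \<union> T = {}")
  case False
  then obtain u where u: "u \<in> S \<union> T" by blast
  have step: "y \<in> S \<union> T" if xy: "(x, y) \<in> adjacency G" and x: "x \<in> S \<union> T" for x y
  proof -
    obtain e where e: "e \<in> edges G" "ends G e = {x, y}" using xy by (auto simp: adjacency_def)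
    then have "{x, y} = {l e, r e}" using ends by simp
    then have "x = l e \<and> y = r e \<or> x = r e \<and> y = l e" by (auto simp: doubleton_eq_iff)
    then show ?thesis using x closed[OF e(1)] lA[OF e(1)] rB[OF e(1)] S T disjoint by auto
  qed
  have "v \<in> S \<union> T" if "v \<in> A \<union> B" for v
  proof -
    have "(u, v) \<in> (adjacency G)\<^sup>*"
      using conn u S T that by (auto simp: connected_graph_def verts)
    then show ?thesis by (induction rule: rtrancl_induct) (use u step in blast)+
  qed
  then have "A \<subseteq> S" "B \<subseteq> T" using S T disjoint by auto
  then show ?thesis using S T by auto
qed auto

lemma matching_double_covered_iff:
  "matching_double_covered G \<longleftrightarrow>
     connected_graph G \<and> (\<forall>e \<in> edges G. card {M. matching M \<and> e \<in> M} = 2)"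
  by (simp add: matching_double_covered_def perfect_matching_iff)

end

section \<open>Uniform bipartite multigraphs up to isomorphism\<close>

text \<open>Replaces isomorphism by counting: \<open>n = 3\<close>, \<open>k = 1\<close> describes
  \<open>complete_bipartite 3 3\<close>, and \<open>n = 2\<close>, \<open>k = 2\<close> describes
  \<open>C44\<close>.\<close>

definition uniform_bipartite :: "nat \<Rightarrow> nat \<Rightarrow> ('v, 'e) multigraph \<Rightarrow> bool" where
  "uniform_bipartite n k G \<longleftrightarrow> (\<exists>A B l r. bipartition G A B l r \<and> card A = n \<and> card B = n \<and>
     (\<forall>a \<in> A. \<forall>b \<in> B. card {e \<in> edges G. l e = a \<and> r e = b} = k))"

lemma bipartition_exists:
  assumes "loopless_multigraph G" "bipartite_graph G"
  shows "\<exists>A B l r. bipartition G A B l r"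
proof -
  obtain A B where AB: "A \<union> B = verts G" "A \<inter> B = {}"
    and "\<forall>e \<in> edges G. \<exists>a \<in> A. \<exists>b \<in> B. ends G e = {a, b}"
    using assms(2) unfolding bipartite_graph_def by (elim exE conjE)
  then have "\<forall>e \<in> edges G. \<exists>p. fst p \<in> A \<and> snd p \<in> B \<and> ends G e = {fst p, snd p}"
    by fastforce
  then obtain p where
    p: "\<forall>e \<in> edges G. fst (p e) \<in> A \<and> snd (p e) \<in> B \<and> ends G e = {fst (p e), snd (p e)}"
    by (rule bchoice[THEN exE])
  define l r where "l e = fst (p e)" and "r e = snd (p e)" for e
  have "\<And>e. e \<in> edges G \<Longrightarrow> l e \<in> A \<and> r e \<in> B \<and> ends G e = {l e, r e}"
    using p by (simp add: l_def r_def)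
  then have "bipartition G A B l r"
    using AB assms(1) by unfold_locales (auto simp: loopless_multigraph_def)
  then show ?thesis by blast
qed

lemma double_covered_uniform:
  assumes G: "loopless_multigraph G" "bipartite_graph G" "edges G \<noteq> {}"
    and mdc: "matching_double_covered G"
  shows "uniform_bipartite 3 1 G \<or> uniform_bipartite 2 2 G"
proof -
  obtain A B l r where bip: "bipartition G A B l r" using bipartition_exists G by blast
  interpret bipartition G A B l r by (rule bip)
  interpret double_covered_bipartite A B "edges G" l r
    using G(3) mdc connected_graph_closed
    by unfold_locales (simp_all add: matching_double_covered_iff)
  show ?thesis using classification bip unfolding uniform_bipartite_def by blast
qed

lemma uniform_connected:
  assumes "uniform_bipartite n k G" "n > 0" "k > 0"
  shows "connected_graph G"
proof -
  obtain A B l r where bip: "bipartition G A B l r" and card: "card A = n" "card B = n"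
    and k: "\<And>a b. a \<in> A \<Longrightarrow> b \<in> B \<Longrightarrow> card {e \<in> edges G. l e = a \<and> r e = b} = k"
    using assms(1) by (auto simp: uniform_bipartite_def)
  interpret bipartition G A B l r by (rule bip)
  have adj: "(a, b) \<in> adjacency G" "(b, a) \<in> adjacency G" if "a \<in> A" "b \<in> B" for a b
  proof -
    have "{e \<in> edges G. l e = a \<and> r e = b} \<noteq> {}" using k[OF that] assms(3) by (metis card.empty less_irrefl)
    then obtain e where "e \<in> edges G" "ends G e = {a, b}" using ends by auto
    then show "(a, b) \<in> adjacency G" "(b, a) \<in> adjacency G"
      by (auto simp: adjacency_def insert_commute)
  qed
  obtain a b where ab: "a \<in> A" "b \<in> B" using card assms(2) by (metis card.empty ex_in_conv less_irrefl)
  have reach: "(a, v) \<in> (adjacency G)\<^sup>* \<and> (v, a) \<in> (adjacency G)\<^sup>*" if "v \<in> A \<union> B" for v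
    using that
  proof
    assume "v \<in> A"
    then show ?thesis using adj ab by (meson converse_rtrancl_into_rtrancl r_into_rtrancl)
  next
    assume "v \<in> B"
    then show ?thesis using adj ab by blast
  qed
  have "(u, v) \<in> (adjacency G)\<^sup>*" if "u \<in> A \<union> B" "v \<in> A \<union> B" for u v
    using reach[OF that(1)] reach[OF that(2)] by (blast intro: rtrancl_trans)
  then show ?thesis using ab by (auto simp: connected_graph_def verts)
qed

lemma uniform_matching_double_covered:
  assumes "uniform_bipartite 3 1 G \<or> uniform_bipartite 2 2 G"
  shows "matching_double_covered G"
  using assms
proof
  assume u: "uniform_bipartite 3 1 G"
  then obtain A B l r where bip: "bipartition G A B l r" and card: "card A = 3" "card B = 3"
    and k: "\<And>a b. a \<in> A \<Longrightarrow> b \<in> B \<Longrightarrow> card {e \<in> edges G. l e = a \<and> r e = b} = 1"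
    by (auto simp: uniform_bipartite_def)
  interpret bipartition G A B l r by (rule bip)
  show ?thesis using card_matchings_through_simple[OF card k] uniform_connected[OF u]
    by (simp add: matching_double_covered_iff)
next
  assume u: "uniform_bipartite 2 2 G"
  then obtain A B l r where bip: "bipartition G A B l r" and card: "card A = 2" "card B = 2"
    and k: "\<And>a b. a \<in> A \<Longrightarrow> b \<in> B \<Longrightarrow> card {e \<in> edges G. l e = a \<and> r e = b} = 2"
    by (auto simp: uniform_bipartite_def)
  interpret bipartition G A B l r by (rule bip)
  have "card {M. matching M \<and> e \<in> M} = 2" if e: "e \<in> edges G" for e
  proof -
    obtain a' where A: "A = {l e, a'}" "l e \<noteq> a'" using card lA[OF e] by (auto simp: card_2_iff)
    obtain b' where B: "B = {r e, b'}" "r e \<noteq> b'" using card rB[OF e] by (auto simp: card_2_iff)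
    show ?thesis using card_matchings_through[OF A B e] k A B by simp
  qed
  then show ?thesis using uniform_connected[OF u] by (simp add: matching_double_covered_iff)
qed

text \<open>Any bijections between the sides extend to an isomorphism, since the edge class of each
  pair is as large as that of the image pair.\<close>

lemma uniform_iso:
  assumes G: "uniform_bipartite n k G" and H: "uniform_bipartite n k H" and k: "k > 0"
  shows "graph_iso G H"
proof -
  obtain A B l r where bG: "bipartition G A B l r" and cG: "card A = n" "card B = n"
    and kG: "\<And>a b. a \<in> A \<Longrightarrow> b \<in> B \<Longrightarrow> card {e \<in> edges G. l e = a \<and> r e = b} = k"
    using G by (auto simp: uniform_bipartite_def)
  obtain A' B' l' r' where bH: "bipartition H A' B' l' r'" and cH: "card A' = n" "card B' = n"
    and kH: "\<And>a b. a \<in> A' \<Longrightarrow> b \<in> B' \<Longrightarrow> card {e \<in> edges H. l' e = a \<and> r' e = b} = k"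
    using H by (auto simp: uniform_bipartite_def)
  interpret G: bipartition G A B l r by (rule bG)
  interpret H: bipartition H A' B' l' r' by (rule bH)
  obtain \<alpha> where \<alpha>: "bij_betw \<alpha> A A'"
    using finite_same_card_bij[of A A'] G.finA H.finA cG cH by auto
  obtain \<beta> where \<beta>: "bij_betw \<beta> B B'"
    using finite_same_card_bij[of B B'] G.finB H.finB cG cH by auto
  define f where "f v = (if v \<in> A then \<alpha> v else \<beta> v)" for v
  have fA: "f v = \<alpha> v" if "v \<in> A" for v using that by (simp add: f_def)
  have fB: "f v = \<beta> v" if "v \<in> B" for v using that G.disjoint by (auto simp: f_def)
  have "bij_betw f A A'" "bij_betw f B B'"
    using \<alpha> \<beta> fA fB by (simp_all cong: bij_betw_cong)
  then have f: "bij_betw f (A \<union> B) (A' \<union> B')" using H.disjoint by (rule bij_betw_combine)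
  define P where "P a b = {e \<in> edges G. l e = a \<and> r e = b}" for a b
  define Q where "Q a b = {e \<in> edges H. l' e = a \<and> r' e = b}" for a b
  have "\<exists>h. bij_betw h (P a b) (Q (\<alpha> a) (\<beta> b))" if "a \<in> A" "b \<in> B" for a b
  proof (rule finite_same_card_bij)
    have "\<alpha> a \<in> A'" "\<beta> b \<in> B'" using \<alpha> \<beta> that by (auto simp: bij_betw_def)
    then show "card (P a b) = card (Q (\<alpha> a) (\<beta> b))" using kG kH that by (simp add: P_def Q_def)
  qed (auto simp: P_def Q_def G.fin H.fin)
  then obtain h where h: "\<And>a b. a \<in> A \<Longrightarrow> b \<in> B \<Longrightarrow> bij_betw (h a b) (P a b) (Q (\<alpha> a) (\<beta> b))"
    by metis
  \<comment> \<open>Gluing the bijections of the classes; as \<open>g\<close> respects end pairs,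
    injectivity and surjectivity reduce to a single class.\<close>
  define g where "g e = h (l e) (r e) e" for e
  have g: "g e \<in> edges H \<and> l' (g e) = \<alpha> (l e) \<and> r' (g e) = \<beta> (r e)" if "e \<in> edges G" for e
  proof -
    have "e \<in> P (l e) (r e)" using that by (simp add: P_def)
    then have "g e \<in> Q (\<alpha> (l e)) (\<beta> (r e))"
      unfolding g_def using h[OF G.lA[OF that] G.rB[OF that]]
      by (rule bij_betwE[rule_format, rotated])
    then show ?thesis by (simp add: Q_def)
  qed
  have "inj_on g (edges G)"
  proof (rule inj_onI)
    fix e e' assume e: "e \<in> edges G" "e' \<in> edges G" "g e = g e'"
    have "\<alpha> (l e) = \<alpha> (l e')" "\<beta> (r e) = \<beta> (r e')" using g[OF e(1)] g[OF e(2)] e(3) by auto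
    then have lr: "l e = l e'" "r e = r e'"
      using \<alpha> \<beta> e G.lA G.rB by (auto simp: bij_betw_def inj_on_def)
    have "inj_on (h (l e) (r e)) (P (l e) (r e))"
      using h[OF G.lA[OF e(1)] G.rB[OF e(1)]] by (simp add: bij_betw_def)
    moreover have "e \<in> P (l e) (r e)" "e' \<in> P (l e) (r e)" using e lr by (auto simp: P_def)
    moreover have "h (l e) (r e) e = h (l e) (r e) e'" using e(3) lr by (simp add: g_def)
    ultimately show "e = e'" by (simp add: inj_on_def)
  qed
  moreover have "g ` edges G = edges H"
  proof
    show "g ` edges G \<subseteq> edges H" using g by blast
    show "edges H \<subseteq> g ` edges G"
    proof
      fix x assume x: "x \<in> edges H"
      obtain a where a: "a \<in> A" "\<alpha> a = l' x" using \<alpha> H.lA[OF x] by (auto simp: bij_betw_def)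
      obtain b where b: "b \<in> B" "\<beta> b = r' x" using \<beta> H.rB[OF x] by (auto simp: bij_betw_def)
      have "x \<in> Q (\<alpha> a) (\<beta> b)" using x a b by (simp add: Q_def)
      then have "x \<in> h a b ` P a b" using h[OF a(1) b(1)] by (simp add: bij_betw_def)
      then obtain e where "e \<in> P a b" "h a b e = x" by blast
      then have "e \<in> edges G" "g e = x" by (auto simp: P_def g_def)
      then show "x \<in> g ` edges G" by blast
    qed
  qed
  moreover have "ends H (g e) = f ` ends G e" if "e \<in> edges G" for e
    using g[OF that] that G.ends H.ends G.lA G.rB fA fB by simp
  ultimately show ?thesis
    unfolding graph_iso_def G.verts H.verts using f by (metis bij_betw_def)
qed

text \<open>The bipartition of \<open>H\<close> is pulled back along the inverse of the vertex
  bijection.\<close>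

lemma uniform_if_iso:
  assumes iso: "graph_iso G H" and G: "loopless_multigraph G" and H: "uniform_bipartite n k H"
  shows "uniform_bipartite n k G"
proof -
  obtain f g where f: "bij_betw f (verts G) (verts H)" and g: "bij_betw g (edges G) (edges H)"
    and fg: "\<And>e. e \<in> edges G \<Longrightarrow> ends H (g e) = f ` ends G e"
    using iso by (auto simp: graph_iso_def)
  obtain A B l r where bH: "bipartition H A B l r" and cH: "card A = n" "card B = n"
    and kH: "\<And>a b. a \<in> A \<Longrightarrow> b \<in> B \<Longrightarrow> card {e \<in> edges H. l e = a \<and> r e = b} = k"
    using H by (auto simp: uniform_bipartite_def)
  interpret H: bipartition H A B l r by (rule bH)
  define f' where "f' = inv_into (verts G) f"
  have f': "bij_betw f' (A \<union> B) (verts G)"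
    using bij_betw_inv_into[OF f] by (simp add: f'_def H.verts)
  have inj: "inj_on f' (A \<union> B)" using f' by (simp add: bij_betw_def)
  have im: "f' ` A \<union> f' ` B = verts G" using f' by (auto simp: bij_betw_def)
  have gE: "g e \<in> edges H" if "e \<in> edges G" for e using g that by (auto simp: bij_betw_def)
  have "bipartition G (f' ` A) (f' ` B) (f' \<circ> l \<circ> g) (f' \<circ> r \<circ> g)"
  proof
    show "verts G = f' ` A \<union> f' ` B" using im by simp
    show "f' ` A \<inter> f' ` B = {}"
      using inj H.disjoint by (auto simp: inj_on_def)
    show "finite (verts G)" "finite (edges G)" using G by (auto simp: loopless_multigraph_def)
    fix e assume e: "e \<in> edges G"
    show "(f' \<circ> l \<circ> g) e \<in> f' ` A" "(f' \<circ> r \<circ> g) e \<in> f' ` B"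
      using gE[OF e] H.lA H.rB by auto
    \<comment> \<open>\<open>f'\<close> is known to undo \<open>f\<close> on \<open>verts G\<close>,
      so the ends of \<open>e\<close> have to lie there.\<close>
    have "ends G e \<subseteq> verts G" using G e by (auto simp: loopless_multigraph_def)
    then have "ends G e = f' ` f ` ends G e"
      using f unfolding f'_def bij_betw_def by simp
    also have "\<dots> = f' ` {l (g e), r (g e)}" using fg[OF e] H.ends[OF gE[OF e]] by simp
    finally show "ends G e = {(f' \<circ> l \<circ> g) e, (f' \<circ> r \<circ> g) e}" by simp
  qed
  moreover have "card (f' ` A) = n" "card (f' ` B) = n"
    using inj cH by (simp_all add: card_image inj_on_Un)
  moreover have "card {e \<in> edges G. (f' \<circ> l \<circ> g) e = f' a \<and> (f' \<circ> r \<circ> g) e = f' b} = k"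
    if "a \<in> A" "b \<in> B" for a b
  proof -
    let ?P = "{e \<in> edges G. (f' \<circ> l \<circ> g) e = f' a \<and> (f' \<circ> r \<circ> g) e = f' b}"
    have "(f' (l (g e)) = f' a \<and> f' (r (g e)) = f' b) = (l (g e) = a \<and> r (g e) = b)"
      if e: "e \<in> edges G" for e
      using inj_onD[OF inj] H.lA[OF gE[OF e]] H.rB[OF gE[OF e]] \<open>a \<in> A\<close> \<open>b \<in> B\<close> by blast
    then have P: "?P = {e \<in> edges G. l (g e) = a \<and> r (g e) = b}" by auto
    have "edges H = g ` edges G" using g by (simp add: bij_betw_def)
    then have "g ` ?P = {e \<in> edges H. l e = a \<and> r e = b}" unfolding P by auto
    moreover have "inj_on g (edges G)" using g by (simp add: bij_betw_def)
    then have "inj_on g ?P" by (rule inj_on_subset) simp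
    ultimately show ?thesis using kH[OF that] card_image[of g ?P] by simp
  qed
  ultimately show ?thesis unfolding uniform_bipartite_def by blast
qed

section \<open>The two target graphs\<close>

lemma uniform_K33: "uniform_bipartite 3 1 (complete_bipartite 3 3)"
proof -
  let ?K = "complete_bipartite 3 3"
  have "bipartition ?K (Inl ` {..<3}) (Inr ` {..<3}) (Inl \<circ> fst) (Inr \<circ> snd)"
    by unfold_locales (auto simp: complete_bipartite_def)
  moreover have "card {e \<in> edges ?K. (Inl \<circ> fst) e = a \<and> (Inr \<circ> snd) e = b} = 1"
    if ab: "a \<in> Inl ` {..<3}" "b \<in> Inr ` {..<3}" for a b :: "nat + nat"
  proof -
    obtain i j where "a = Inl i" "i < 3" "b = Inr j" "j < 3" using ab by auto
    then have "{e \<in> edges ?K. (Inl \<circ> fst) e = a \<and> (Inr \<circ> snd) e = b} = {(i, j)}"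
      by (auto simp: complete_bipartite_def)
    then show ?thesis by simp
  qed
  ultimately show ?thesis unfolding uniform_bipartite_def
    by (intro exI conjI ballI) (assumption | simp add: card_image)+
qed

lemma uniform_C44: "uniform_bipartite 2 2 C44"
proof -
  have lt4: "i < 4 \<longleftrightarrow> i \<in> {0, 1, 2, 3}" for i :: nat by auto
  \<comment> \<open>The even vertices form the left side. Cycle edge \<open>i\<close> joins
    \<open>i\<close> and \<open>i + 1\<close> modulo 4, so edges 0 and 3 meet vertex 0, and edges 0
    and 1 meet vertex 1.\<close>
  define l r :: "nat \<times> bool \<Rightarrow> nat" where
    "l e = (if fst e \<in> {0, 3} then 0 else 2)" and "r e = (if fst e \<in> {0, 1} then 1 else 3)" for e
  have E: "edges C44 = {0, 1, 2, 3} \<times> UNIV"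
    by (auto simp: C44_def double_edges_def cycle_graph_def lt4)
  have "bipartition C44 {0, 2} {1, 3} l r"
    by unfold_locales
      (auto simp: C44_def double_edges_def cycle_graph_def lt4 l_def r_def)
  moreover have "card {e \<in> edges C44. l e = a \<and> r e = b} = 2"
    if ab: "a \<in> {0, 2}" "b \<in> {1, 3}" for a b
  proof -
    \<comment> \<open>The only cycle edge between \<open>a\<close> and \<open>b\<close>; its two
      tagged copies give multiplicity 2.\<close>
    define i :: nat where "i = (if a = 0 then if b = 1 then 0 else 3 else if b = 1 then 1 else 2)"
    have lr: "l (j, t) = a \<and> r (j, t) = b \<longleftrightarrow> j = i" if "j \<in> {0, 1, 2, 3}" for j t
      using that ab unfolding l_def r_def i_def by auto
    have "(j, t) \<in> {e \<in> edges C44. l e = a \<and> r e = b} \<longleftrightarrow> (j, t) \<in> {i} \<times> UNIV" for j t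
    proof (cases "j \<in> {0, 1, 2, 3}")
      case True
      then show ?thesis using lr[OF True] by (simp add: E)
    qed (auto simp: E i_def)
    then have "{e \<in> edges C44. l e = a \<and> r e = b} = {i} \<times> UNIV" by auto
    then show ?thesis by (simp add: card_cartesian_product)
  qed
  ultimately show ?thesis unfolding uniform_bipartite_def
    by (intro exI conjI ballI) (assumption | simp)+
qed

theorem corollary1p7:
  fixes G :: "('v, 'e) multigraph"
  assumes "loopless_multigraph G"
    and "edges G \<noteq> {}"
    and "\<exists>M. perfect_matching G M"
    and "bipartite_graph G"
  shows "matching_double_covered G \<longleftrightarrow>
           graph_iso G (complete_bipartite 3 3) \<or> graph_iso G C44"
proof
  assume "matching_double_covered G"
  then have "uniform_bipartite 3 1 G \<or> uniform_bipartite 2 2 G"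
    by (rule double_covered_uniform[OF assms(1,4,2)])
  then show "graph_iso G (complete_bipartite 3 3) \<or> graph_iso G C44"
    using uniform_iso[OF _ uniform_K33] uniform_iso[OF _ uniform_C44] by auto
next
  assume "graph_iso G (complete_bipartite 3 3) \<or> graph_iso G C44"
  then have "uniform_bipartite 3 1 G \<or> uniform_bipartite 2 2 G"
    using uniform_if_iso[OF _ assms(1) uniform_K33] uniform_if_iso[OF _ assms(1) uniform_C44]
    by blast
  then show "matching_double_covered G" by (rule uniform_matching_double_covered)
qed

end
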